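(* Let $A$ be the $*$-semigroup described in the context and let $\mathcal{P}$ be the universal $C^*$-algebra generated by a partial isometry $v$. There is a contractive $*$-semigroup homomorphism $\sigma:A\rightarrow\mathcal{P}$ defined by mapping the element $(1)$ of $A$ to the partial isometry $v$ of $\mathcal{P}$. The induced $*$-homomorphism $\pi_{\sigma}:C^{*}(A)\rightarrow\mathcal{P}$ (the unique one with $\pi_\sigma\circ\iota=\sigma$) is a $*$-isomorphism of $C^*$-algebras.
   Context: A $*$-semigroup is a semigroup with an involutive map $*$ satisfying $(ab)^*=b^*a^*$; $*$-semigroup homomorphisms preserve product and $*$. A $C^*$-algebra is a $*$-semigroup under multiplication; a $*$-semigroup homomorphism into a $C^*$-algebra is contractive if all its values have norm $\le 1$. The $*$-semigroup $A$: let $A_c$ be the set of finite nonempty sequences $(n_0,\dots,n_k)$ of nonzero integers with alternating signs; multiplication is concatenation, where the last entry of the left factor and the first entry of the right factor are added into a single entry if they have the same sign; the involution is $(n_0,\dots,n_k)^*=(-n_k,\dots,-n_0)$. $A$ is the quotient $*$-semigroup of $A_c$ by the congruence generated by $(n_0,\dots,n_k)\sim(n_0,\dots,n_{i-1},n_i+n_{i+1}+n_{i+2},n_{i+3},\dots,n_k)$ whenever $0\le i\le k-2$ and $n_{i+1}=\pm1$. For a $*$-semigroup $S$, the universal $C^*$-algebra $C^*(S)$ is a $C^*$-algebra together with a contractive $*$-semigroup homomorphism $\iota:S\to C^*(S)$ such that for every contractive $*$-semigroup homomorphism $\gamma:S\to B$ to a $C^*$-algebra $B$ there is a unique $*$-homomorphism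 $\pi_\gamma:C^*(S)\to B$ with $\pi_\gamma\circ\iota=\gamma$. $\mathcal{P}$ is the universal $C^*$-algebra with one generator $v$ subject to $vv^*v=v$ (no unit is required). *)

theory Defs
  imports Complex_Main "HOL-Algebra.Group"
begin

section \<open>\<open>*\<close>-semigroups\<close>

record 'a star_semigroup = "'a partial_object" +
  sprod :: "'a \<Rightarrow> 'a \<Rightarrow> 'a" (infixl "\<odot>\<index>" 70)
  star :: "'a \<Rightarrow> 'a" ("\<star>\<index> _" [81] 80)

locale star_semigroup =
  fixes S (structure)
  assumes sprod_closed: "\<lbrakk>x \<in> carrier S; y \<in> carrier S\<rbrakk> \<Longrightarrow> x \<odot> y \<in> carrier S"
    and sprod_assoc: "\<lbrakk>x \<in> carrier S; y \<in> carrier S; z \<in> carrier S\<rbrakk>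
      \<Longrightarrow> (x \<odot> y) \<odot> z = x \<odot> (y \<odot> z)"
    and star_closed: "x \<in> carrier S \<Longrightarrow> \<star> x \<in> carrier S"
    and star_star: "x \<in> carrier S \<Longrightarrow> \<star> (\<star> x) = x"
    and star_sprod: "\<lbrakk>x \<in> carrier S; y \<in> carrier S\<rbrakk> \<Longrightarrow> \<star> (x \<odot> y) = \<star> y \<odot> \<star> x"

text \<open>Homomorphisms are extensional functions, so that equality of homomorphisms (and hence
  \<open>\<exists>!\<close>) means equality on the carrier of the source.\<close>

definition star_hom ::
  "('a, 'm) star_semigroup_scheme \<Rightarrow> ('b, 'n) star_semigroup_scheme \<Rightarrow> ('a \<Rightarrow> 'b) set" where
  "star_hom S T = {f \<in> carrier S \<rightarrow>\<^sub>E carrier T.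
     (\<forall>x\<in>carrier S. \<forall>y\<in>carrier S. f (x \<odot>\<^bsub>S\<^esub> y) = f x \<odot>\<^bsub>T\<^esub> f y) \<and>
     (\<forall>x\<in>carrier S. f (\<star>\<^bsub>S\<^esub> x) = \<star>\<^bsub>T\<^esub> (f x))}"

definition star_congruence :: "('a, 'm) star_semigroup_scheme \<Rightarrow> ('a \<times> 'a) set \<Rightarrow> bool" where
  "star_congruence S r \<longleftrightarrow> equiv (carrier S) r \<and>
     (\<forall>x x' y y'. (x, x') \<in> r \<and> (y, y') \<in> r \<longrightarrow> (x \<odot>\<^bsub>S\<^esub> y, x' \<odot>\<^bsub>S\<^esub> y') \<in> r) \<and>
     (\<forall>x x'. (x, x') \<in> r \<longrightarrow> (\<star>\<^bsub>S\<^esub> x, \<star>\<^bsub>S\<^esub> x') \<in> r)"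

definition gen_congruence ::
  "('a, 'm) star_semigroup_scheme \<Rightarrow> ('a \<times> 'a) set \<Rightarrow> ('a \<times> 'a) set" where
  "gen_congruence S R = \<Inter>{r. star_congruence S r \<and> R \<subseteq> r}"

definition quotient_star_semigroup ::
  "('a, 'm) star_semigroup_scheme \<Rightarrow> ('a \<times> 'a) set \<Rightarrow> 'a set star_semigroup" where
  "quotient_star_semigroup S r = \<lparr>carrier = carrier S // r,
     sprod = (\<lambda>X Y. \<Union>x\<in>X. \<Union>y\<in>Y. r `` {x \<odot>\<^bsub>S\<^esub> y}),
     star = (\<lambda>X. \<Union>x\<in>X. r `` {\<star>\<^bsub>S\<^esub> x})\<rparr>"


section \<open>The \<open>*\<close>-semigroup \<open>A\<close>\<close>

definition Ac :: "int list star_semigroup" where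
  "Ac = \<lparr>carrier = {xs. xs \<noteq> [] \<and> 0 \<notin> set xs \<and> successively (\<lambda>m n. sgn n = - sgn m) xs},
     sprod = (\<lambda>xs ys. if sgn (last xs) = sgn (hd ys)
                        then butlast xs @ [last xs + hd ys] @ tl ys
                        else xs @ ys),
     star = (\<lambda>xs. map uminus (rev xs))\<rparr>"

definition A_rel :: "(int list \<times> int list) set" where
  "A_rel = {(us @ [a, e, b] @ vs, us @ [a + e + b] @ vs) | us a e b vs.
     us @ [a, e, b] @ vs \<in> carrier Ac \<and> (e = 1 \<or> e = -1)}"

definition A_cong :: "(int list \<times> int list) set" where
  "A_cong = gen_congruence Ac A_rel"

definition A :: "int list set star_semigroup" where
  "A = quotient_star_semigroup Ac A_cong"

definition A_class :: "int list \<Rightarrow> int list set" where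
  "A_class xs = A_cong `` {xs}"


section \<open>\<open>C\<^sup>*\<close>-algebras\<close>

record 'a cstar_algebra = "'a star_semigroup" +
  cadd :: "'a \<Rightarrow> 'a \<Rightarrow> 'a" (infixl "\<oplus>\<index>" 65)
  czero :: 'a ("\<zero>\<index>")
  cscale :: "complex \<Rightarrow> 'a \<Rightarrow> 'a" (infixr "\<cdot>\<index>" 75)
  cnorm :: "'a \<Rightarrow> real" ("\<parallel>_\<parallel>\<index>")

text \<open>No unit is required, and the zero algebra is allowed.\<close>

locale cstar_algebra = star_semigroup B for B (structure) +
  assumes add_comm_group: "comm_group \<lparr>carrier = carrier B, mult = cadd B, one = czero B\<rparr>"
    and scale_closed: "x \<in> carrier B \<Longrightarrow> a \<cdot> x \<in> carrier B"
    and scale_add: "\<lbrakk>x \<in> carrier B; y \<in> carrier B\<rbrakk> \<Longrightarrow> a \<cdot> (x \<oplus> y) = a \<cdot> x \<oplus> a \<cdot> y"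
    and add_scale: "x \<in> carrier B \<Longrightarrow> (a + b) \<cdot> x = a \<cdot> x \<oplus> b \<cdot> x"
    and scale_scale: "x \<in> carrier B \<Longrightarrow> a \<cdot> (b \<cdot> x) = (a * b) \<cdot> x"
    and scale_one: "x \<in> carrier B \<Longrightarrow> 1 \<cdot> x = x"
    and distrib_left: "\<lbrakk>x \<in> carrier B; y \<in> carrier B; z \<in> carrier B\<rbrakk>
      \<Longrightarrow> x \<odot> (y \<oplus> z) = x \<odot> y \<oplus> x \<odot> z"
    and distrib_right: "\<lbrakk>x \<in> carrier B; y \<in> carrier B; z \<in> carrier B\<rbrakk>
      \<Longrightarrow> (x \<oplus> y) \<odot> z = x \<odot> z \<oplus> y \<odot> z"
    and scale_sprod: "\<lbrakk>x \<in> carrier B; y \<in> carrier B\<rbrakk> \<Longrightarrow> (a \<cdot> x) \<odot> y = a \<cdot> (x \<odot> y)"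
    and sprod_scale: "\<lbrakk>x \<in> carrier B; y \<in> carrier B\<rbrakk> \<Longrightarrow> x \<odot> (a \<cdot> y) = a \<cdot> (x \<odot> y)"
    and star_add: "\<lbrakk>x \<in> carrier B; y \<in> carrier B\<rbrakk> \<Longrightarrow> \<star> (x \<oplus> y) = \<star> x \<oplus> \<star> y"
    and star_scale: "x \<in> carrier B \<Longrightarrow> \<star> (a \<cdot> x) = cnj a \<cdot> (\<star> x)"
    and norm_nonneg: "x \<in> carrier B \<Longrightarrow> 0 \<le> \<parallel>x\<parallel>"
    and norm_eq_0_iff: "x \<in> carrier B \<Longrightarrow> \<parallel>x\<parallel> = 0 \<longleftrightarrow> x = \<zero>"
    and norm_triangle: "\<lbrakk>x \<in> carrier B; y \<in> carrier B\<rbrakk> \<Longrightarrow> \<parallel>x \<oplus> y\<parallel> \<le> \<parallel>x\<parallel> + \<parallel>y\<parallel>"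
    and norm_scale: "x \<in> carrier B \<Longrightarrow> \<parallel>a \<cdot> x\<parallel> = cmod a * \<parallel>x\<parallel>"
    and norm_sprod: "\<lbrakk>x \<in> carrier B; y \<in> carrier B\<rbrakk> \<Longrightarrow> \<parallel>x \<odot> y\<parallel> \<le> \<parallel>x\<parallel> * \<parallel>y\<parallel>"
    and cstar_identity: "x \<in> carrier B \<Longrightarrow> \<parallel>\<star> x \<odot> x\<parallel> = \<parallel>x\<parallel>\<^sup>2"
    and complete:
      "\<lbrakk>\<And>n :: nat. X n \<in> carrier B;
        \<And>e :: real. 0 < e \<Longrightarrow> \<exists>N. \<forall>m\<ge>N. \<forall>n\<ge>N. \<parallel>X m \<oplus> (- 1) \<cdot> X n\<parallel> < e\<rbrakk>
       \<Longrightarrow> \<exists>x\<in>carrier B. (\<lambda>n. \<parallel>X n \<oplus> (- 1) \<cdot> x\<parallel>) \<longlonglongrightarrow> 0"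

definition cstar_hom :: "'a cstar_algebra \<Rightarrow> 'b cstar_algebra \<Rightarrow> ('a \<Rightarrow> 'b) set" where
  "cstar_hom B D = {f \<in> star_hom B D.
     (\<forall>x\<in>carrier B. \<forall>y\<in>carrier B. f (x \<oplus>\<^bsub>B\<^esub> y) = f x \<oplus>\<^bsub>D\<^esub> f y) \<and>
     (\<forall>a. \<forall>x\<in>carrier B. f (a \<cdot>\<^bsub>B\<^esub> x) = a \<cdot>\<^bsub>D\<^esub> f x)}"

definition cstar_iso :: "'a cstar_algebra \<Rightarrow> 'b cstar_algebra \<Rightarrow> ('a \<Rightarrow> 'b) set" where
  "cstar_iso B D = {f \<in> cstar_hom B D. bij_betw f (carrier B) (carrier D)}"

definition contractive_hom ::
  "('s, 'm) star_semigroup_scheme \<Rightarrow> 'a cstar_algebra \<Rightarrow> ('s \<Rightarrow> 'a) set" where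
  "contractive_hom S B = {\<gamma> \<in> star_hom S B. \<forall>s\<in>carrier S. \<parallel>\<gamma> s\<parallel>\<^bsub>B\<^esub> \<le> 1}"


section \<open>Universal \<open>C\<^sup>*\<close>-algebras\<close>

text \<open>HOL cannot quantify over types inside a formula, so the test algebras \<open>B\<close> below range over
  all \<open>C\<^sup>*\<close>-algebras whose carrier is a subset of the type \<open>'u\<close> that also carries the universal
  algebra.  A hypothesis that an algebra is universal in this sense is implied by universality
  among all \<open>C\<^sup>*\<close>-algebras.  For countable \<open>S\<close> the two agree as soon as \<open>'u\<close> has at least the
  cardinality of the continuum: a test homomorphism may be corestricted to the separable
  \<open>C\<^sup>*\<close>-subalgebra generated by its image, which has a copy inside \<open>'u\<close>.\<close>

definition is_universal_cstar ::
  "('s, 'm) star_semigroup_scheme \<Rightarrow> 'u cstar_algebra \<Rightarrow> ('s \<Rightarrow> 'u) \<Rightarrow> bool" where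
  "is_universal_cstar S C \<iota> \<longleftrightarrow> cstar_algebra C \<and> \<iota> \<in> contractive_hom S C \<and>
     (\<forall>(B :: 'u cstar_algebra) \<gamma>. cstar_algebra B \<and> \<gamma> \<in> contractive_hom S B \<longrightarrow>
        (\<exists>!\<pi>. \<pi> \<in> cstar_hom C B \<and> (\<forall>s\<in>carrier S. \<pi> (\<iota> s) = \<gamma> s)))"

definition induced_hom ::
  "('s, 'm) star_semigroup_scheme \<Rightarrow> 'u cstar_algebra \<Rightarrow> ('s \<Rightarrow> 'u) \<Rightarrow> 'u cstar_algebra
     \<Rightarrow> ('s \<Rightarrow> 'u) \<Rightarrow> ('u \<Rightarrow> 'u)" where
  "induced_hom S C \<iota> B \<gamma> =
     (THE \<pi>. \<pi> \<in> cstar_hom C B \<and> (\<forall>s\<in>carrier S. \<pi> (\<iota> s) = \<gamma> s))"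

definition partial_isometry :: "('a, 'm) star_semigroup_scheme \<Rightarrow> 'a \<Rightarrow> bool" where
  "partial_isometry B v \<longleftrightarrow> v \<in> carrier B \<and> v \<odot>\<^bsub>B\<^esub> (\<star>\<^bsub>B\<^esub> v) \<odot>\<^bsub>B\<^esub> v = v"

text \<open>The uniqueness of \<open>\<pi>\<close> expresses that \<open>v\<close> generates \<open>P\<close> as a \<open>C\<^sup>*\<close>-algebra.\<close>

definition is_universal_partial_isometry :: "'u cstar_algebra \<Rightarrow> 'u \<Rightarrow> bool" where
  "is_universal_partial_isometry P v \<longleftrightarrow> cstar_algebra P \<and> partial_isometry P v \<and>
     (\<forall>(B :: 'u cstar_algebra) w. cstar_algebra B \<and> partial_isometry B w \<longrightarrow>
        (\<exists>!\<pi>. \<pi> \<in> cstar_hom P B \<and> \<pi> v = w))"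


section \<open>\<open>A\<close> is a \<open>*\<close>-semigroup\<close>

lemma star_congruence_gen:
  assumes "star_semigroup S" "R \<subseteq> carrier S \<times> carrier S"
  shows "star_congruence S (gen_congruence S R)"
proof -
  interpret star_semigroup S by fact
  let ?K = "{r. star_congruence S r \<and> R \<subseteq> r}"
  have top: "carrier S \<times> carrier S \<in> ?K"
    using assms(2) by (auto simp: star_congruence_def equiv_def refl_on_def sym_def trans_def
        sprod_closed star_closed)
  show ?thesis
    unfolding gen_congruence_def star_congruence_def[of S "\<Inter> ?K"]
  proof (intro conjI allI impI)
    show "equiv (carrier S) (\<Inter> ?K)"
    proof (rule equivI)
      show "\<Inter> ?K \<subseteq> carrier S \<times> carrier S" using top by blast
      show "refl_on (carrier S) (\<Inter> ?K)"
        by (auto simp: star_congruence_def equiv_def refl_on_def)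
      show "sym (\<Inter> ?K)"
        by (intro sym_INTER[of _ id, simplified]) (simp add: star_congruence_def equiv_def)
      show "trans (\<Inter> ?K)"
        by (intro trans_INTER[of _ id, simplified]) (simp add: star_congruence_def equiv_def)
    qed
  qed (auto simp: star_congruence_def)
qed

lemma star_semigroup_quotient:
  assumes "star_semigroup S" "star_congruence S r"
  shows "star_semigroup (quotient_star_semigroup S r)"
proof -
  interpret star_semigroup S by fact
  let ?Q = "quotient_star_semigroup S r"
  have eq: "equiv (carrier S) r" using assms(2) by (simp add: star_congruence_def)
  have cls: "r `` {x} = r `` {y}" if "(x, y) \<in> r" for x y
    using eq that by (rule equiv_class_eq)
  have self: "x \<in> r `` {x}" if "x \<in> carrier S" for x
    using eq that by (rule equiv_class_self)
  have cp: "(x \<odot>\<^bsub>S\<^esub> y, x' \<odot>\<^bsub>S\<^esub> y') \<in> r" if "(x, x') \<in> r" "(y, y') \<in> r" for x x' y y'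
    using assms(2) that unfolding star_congruence_def by blast
  have cs: "(\<star>\<^bsub>S\<^esub> x, \<star>\<^bsub>S\<^esub> x') \<in> r" if "(x, x') \<in> r" for x x'
    using assms(2) that unfolding star_congruence_def by blast
  have p: "r `` {x} \<odot>\<^bsub>?Q\<^esub> r `` {y} = r `` {x \<odot>\<^bsub>S\<^esub> y}"
    if "x \<in> carrier S" "y \<in> carrier S" for x y
  proof -
    have "(\<Union>x'\<in>r `` {x}. \<Union>y'\<in>r `` {y}. r `` {x' \<odot>\<^bsub>S\<^esub> y'}) = r `` {x \<odot>\<^bsub>S\<^esub> y}"
    proof (intro equalityI UN_least)
      fix x' y' assume "x' \<in> r `` {x}" "y' \<in> r `` {y}"
      then show "r `` {x' \<odot>\<^bsub>S\<^esub> y'} \<subseteq> r `` {x \<odot>\<^bsub>S\<^esub> y}"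
        using cls[OF cp, of x x' y y'] by simp
    next
      show "r `` {x \<odot>\<^bsub>S\<^esub> y} \<subseteq> (\<Union>x'\<in>r `` {x}. \<Union>y'\<in>r `` {y}. r `` {x' \<odot>\<^bsub>S\<^esub> y'})"
        using self[OF that(1)] self[OF that(2)] by (intro subsetI UN_I)
    qed
    then show ?thesis by (simp add: quotient_star_semigroup_def)
  qed
  have s: "\<star>\<^bsub>?Q\<^esub> (r `` {x}) = r `` {\<star>\<^bsub>S\<^esub> x}" if "x \<in> carrier S" for x
  proof -
    have "(\<Union>x'\<in>r `` {x}. r `` {\<star>\<^bsub>S\<^esub> x'}) = r `` {\<star>\<^bsub>S\<^esub> x}"
    proof (intro equalityI UN_least)
      fix x' assume "x' \<in> r `` {x}"
      then show "r `` {\<star>\<^bsub>S\<^esub> x'} \<subseteq> r `` {\<star>\<^bsub>S\<^esub> x}"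
        using cls[OF cs, of x x'] by simp
    next
      show "r `` {\<star>\<^bsub>S\<^esub> x} \<subseteq> (\<Union>x'\<in>r `` {x}. r `` {\<star>\<^bsub>S\<^esub> x'})"
        using self[OF that] by (intro subsetI UN_I)
    qed
    then show ?thesis by (simp add: quotient_star_semigroup_def)
  qed
  have c: "X \<in> carrier ?Q \<longleftrightarrow> (\<exists>x\<in>carrier S. X = r `` {x})" for X
    by (auto simp: quotient_star_semigroup_def quotient_def)
  show ?thesis
  proof
    fix X Y Z assume "X \<in> carrier ?Q" "Y \<in> carrier ?Q" "Z \<in> carrier ?Q"
    then show "(X \<odot>\<^bsub>?Q\<^esub> Y) \<odot>\<^bsub>?Q\<^esub> Z = X \<odot>\<^bsub>?Q\<^esub> (Y \<odot>\<^bsub>?Q\<^esub> Z)"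
      unfolding c by (auto simp: p sprod_closed sprod_assoc)
  next
    fix X Y assume "X \<in> carrier ?Q" "Y \<in> carrier ?Q"
    then show "X \<odot>\<^bsub>?Q\<^esub> Y \<in> carrier ?Q"
      unfolding c using p sprod_closed by metis
  next
    fix X assume "X \<in> carrier ?Q"
    then show "\<star>\<^bsub>?Q\<^esub> X \<in> carrier ?Q"
      unfolding c using s star_closed by metis
  next
    fix X assume "X \<in> carrier ?Q"
    then show "\<star>\<^bsub>?Q\<^esub> (\<star>\<^bsub>?Q\<^esub> X) = X"
      unfolding c by (auto simp: s star_closed star_star)
  next
    fix X Y assume "X \<in> carrier ?Q" "Y \<in> carrier ?Q"
    then show "\<star>\<^bsub>?Q\<^esub> (X \<odot>\<^bsub>?Q\<^esub> Y) = \<star>\<^bsub>?Q\<^esub> Y \<odot>\<^bsub>?Q\<^esub> \<star>\<^bsub>?Q\<^esub> X"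
      unfolding c by (auto simp: s p star_closed sprod_closed star_sprod)
  qed
qed

lemma sgn_add_same: "sgn a = sgn b \<Longrightarrow> sgn (a + b) = sgn (a :: int)"
  by (auto simp: sgn_if split: if_splits)

lemma sgn_opp: "a \<noteq> 0 \<Longrightarrow> b \<noteq> 0 \<Longrightarrow> sgn a \<noteq> sgn b \<Longrightarrow> sgn b = - sgn (a :: int)"
  by (auto simp: sgn_if split: if_splits)

lemma A_c_ends:
  assumes "xs \<in> carrier Ac"
  shows "last xs \<noteq> 0" "hd xs \<noteq> 0" "xs \<noteq> []"
  using assms by (auto simp: Ac_def) (metis last_in_set, metis hd_in_set)

lemma star_semigroup_Ac: "star_semigroup Ac"
proof
  fix xs ys assume x: "xs \<in> carrier Ac" and y: "ys \<in> carrier Ac"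
  note ends = A_c_ends[OF x] A_c_ends[OF y]
  obtain us a where xs: "xs = us @ [a]" using ends by (metis rev_exhaust)
  obtain b vs where ys: "ys = b # vs" using ends by (metis list.exhaust)
  have nz: "a \<noteq> 0" "b \<noteq> 0" using ends xs ys by auto
  show "xs \<odot>\<^bsub>Ac\<^esub> ys \<in> carrier Ac"
  proof (cases "sgn a = sgn b")
    case True
    then have "sgn (a + b) = sgn a" "sgn (a + b) = sgn b" by (simp_all add: sgn_add_same)
    moreover from this have "a + b \<noteq> 0" using nz by (metis sgn_0_0)
    ultimately show ?thesis using x y nz True
      by (auto simp: Ac_def xs ys successively_append_iff successively_Cons)
  next
    case False
    then have "sgn b = - sgn a" using nz sgn_opp by blast
    then show ?thesis using x y nz False
      by (auto simp: Ac_def xs ys successively_append_iff successively_Cons)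
  qed
  show "\<star>\<^bsub>Ac\<^esub> (xs \<odot>\<^bsub>Ac\<^esub> ys) = \<star>\<^bsub>Ac\<^esub> ys \<odot>\<^bsub>Ac\<^esub> \<star>\<^bsub>Ac\<^esub> xs"
    by (auto simp: Ac_def xs ys sgn_minus)
next
  fix xs assume x: "xs \<in> carrier Ac"
  show "\<star>\<^bsub>Ac\<^esub> xs \<in> carrier Ac"
  proof -
    have "successively (\<lambda>m n :: int. - sgn m = sgn n) = successively (\<lambda>m n. sgn n = - sgn m)"
      by (intro arg_cong[where f = successively] ext) auto
    then show ?thesis
      using x by (auto simp: Ac_def successively_map)
  qed
  show "\<star>\<^bsub>Ac\<^esub> (\<star>\<^bsub>Ac\<^esub> xs) = xs" by (simp add: Ac_def rev_map comp_def)
next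
  fix xs ys zs assume x: "xs \<in> carrier Ac" and y: "ys \<in> carrier Ac" and z: "zs \<in> carrier Ac"
  note ends = A_c_ends[OF x] A_c_ends[OF y] A_c_ends[OF z]
  obtain us a where xs: "xs = us @ [a]" using ends by (metis rev_exhaust)
  obtain b vs where zs: "zs = b # vs" using ends by (metis list.exhaust)
  have ys: "(\<exists>c. ys = [c]) \<or> (\<exists>c ws d. ys = c # ws @ [d])"
    using ends by (metis list.exhaust rev_exhaust)
  show "(xs \<odot>\<^bsub>Ac\<^esub> ys) \<odot>\<^bsub>Ac\<^esub> zs = xs \<odot>\<^bsub>Ac\<^esub> (ys \<odot>\<^bsub>Ac\<^esub> zs)"
    using ys
  proof (elim disjE exE)
    fix c assume c: "ys = [c]"
    have "sgn a = sgn c \<Longrightarrow> sgn (a + c) = sgn c" "sgn c = sgn b \<Longrightarrow> sgn (c + b) = sgn c"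
      by (simp_all add: sgn_add_same)
    then show ?thesis
      by (cases "sgn a = sgn c"; cases "sgn c = sgn b") (simp_all add: Ac_def xs zs c butlast_append)
  next
    fix c ws d assume c: "ys = c # ws @ [d]"
    show ?thesis
      by (cases "sgn a = sgn c"; cases "sgn d = sgn b") (simp_all add: Ac_def xs zs c butlast_append)
  qed
qed

lemma A_rel_subset: "A_rel \<subseteq> carrier Ac \<times> carrier Ac"
proof -
  have "us @ [a + e + b] @ vs \<in> carrier Ac"
    if "us @ [a, e, b] @ vs \<in> carrier Ac" "e = 1 \<or> e = -1" for us vs :: "int list" and a e b
  proof -
    have "a \<noteq> 0" "b \<noteq> 0" "sgn a = - e" "sgn b = - e" using that
      by (auto simp: Ac_def successively_append_iff successively_Cons)
    then have "sgn (a + e + b) = sgn a" "sgn (a + e + b) = sgn b" "a + e + b \<noteq> 0"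
      using that(2) by (auto simp: sgn_if split: if_splits)
    moreover have "successively (\<lambda>m n. sgn n = - sgn m) us" "0 \<notin> set us" "0 \<notin> set vs"
      "us = [] \<or> sgn a = - sgn (last us)" "vs = [] \<or> (sgn (hd vs) = - sgn b \<and> successively (\<lambda>m n. sgn n = - sgn m) vs)"
      using that(1) by (auto simp: Ac_def successively_append_iff successively_Cons)
    ultimately show ?thesis
      by (simp add: Ac_def successively_append_iff successively_Cons)
  qed
  then show ?thesis unfolding A_rel_def by blast
qed

lemma star_semigroup_A: "star_semigroup A"
  unfolding A_def A_cong_def
  by (intro star_semigroup_quotient star_congruence_gen star_semigroup_Ac A_rel_subset)

end

theory Submission
  imports Defs
begin

text \<open>
  The reason behind the theorem is that \<open>A\<close> is itself given by one generator and one relation: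
  it is the universal \<open>*\<close>-semigroup on an element \<open>x\<close> with \<open>x x\<^sup>* x = x\<close>.  Indeed, reading an entry
  \<open>n > 0\<close> as \<open>x\<^sup>n\<close> and \<open>n < 0\<close> as \<open>(x\<^sup>*)\<^bsup>-n\<^esup>\<close> identifies \<open>A\<^sub>c\<close> with the nonempty words in
  \<open>x\<close> and \<open>x\<^sup>*\<close>, and the relations \<open>(a, \<plusminus>1, b) \<sim> (a \<plusminus> 1 + b)\<close> replace \<open>x x\<^sup>* x\<close> by
  \<open>x\<close>, or \<open>x\<^sup>* x x\<^sup>*\<close> by \<open>x\<^sup>*\<close>, inside a word (\<open>unary_word_A_rel\<close>).  So every
  partial isometry \<open>w\<close> of a \<open>*\<close>-semigroup is the image of \<open>(1)\<close> under a homomorphism from \<open>A\<close>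
  (\<open>A_hom_exists\<close>), which is unique because \<open>(1)\<close> generates \<open>A\<close> (\<open>A_hom_unique\<close>); and \<open>(1)\<close> is
  a partial isometry itself (\<open>partial_isometry_A_generator\<close>).

  Partial isometries of a \<open>C\<^sup>*\<close>-algebra have norm at most 1, so these homomorphisms are
  contractive.  Hence contractive homomorphisms from \<open>A\<close> into a \<open>C\<^sup>*\<close>-algebra \<open>B\<close> correspond to
  partial isometries of \<open>B\<close>, and \<open>C\<^sup>*(A)\<close> and \<open>\<P>\<close> have the same universal property: the
  homomorphism \<open>\<pi>\<^sub>\<sigma>\<close> sends \<open>\<iota>(1)\<close> to \<open>v\<close>, the universal property of \<open>\<P>\<close> gives a homomorphism
  sending \<open>v\<close> to \<open>\<iota>(1)\<close>, and the composites fix \<open>v\<close> and \<open>\<iota>(1)\<close>.  As \<open>(1)\<close> generates \<open>A\<close>, fixing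
  \<open>\<iota>(1)\<close> means fixing all of \<open>\<iota>(A)\<close>, so both composites are identities by the uniqueness parts of
  the universal properties.
\<close>


section \<open>Quotients of \<open>*\<close>-semigroups\<close>

lemma quotient_sprod_class:
  assumes "star_congruence S r" "x \<in> carrier S" "y \<in> carrier S"
  shows "r `` {x} \<odot>\<^bsub>quotient_star_semigroup S r\<^esub> r `` {y} = r `` {x \<odot>\<^bsub>S\<^esub> y}"
proof -
  have eq: "equiv (carrier S) r" using assms(1) by (simp add: star_congruence_def)
  have "congruent2 r r (\<lambda>x y. r `` {x \<odot>\<^bsub>S\<^esub> y})"
  proof (rule congruent2I')
    fix x x' y y' assume "(x, x') \<in> r" "(y, y') \<in> r"
    then have "(x \<odot>\<^bsub>S\<^esub> y, x' \<odot>\<^bsub>S\<^esub> y') \<in> r"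
      using assms(1) unfolding star_congruence_def by blast
    then show "r `` {x \<odot>\<^bsub>S\<^esub> y} = r `` {x' \<odot>\<^bsub>S\<^esub> y'}" using eq by (rule equiv_class_eq[rotated])
  qed
  from UN_equiv_class2[OF eq eq this assms(2,3)] show ?thesis
    by (simp add: quotient_star_semigroup_def)
qed

lemma quotient_star_class:
  assumes "star_congruence S r" "x \<in> carrier S"
  shows "\<star>\<^bsub>quotient_star_semigroup S r\<^esub> (r `` {x}) = r `` {\<star>\<^bsub>S\<^esub> x}"
proof -
  have eq: "equiv (carrier S) r" using assms(1) by (simp add: star_congruence_def)
  have "congruent r (\<lambda>x. r `` {\<star>\<^bsub>S\<^esub> x})"
  proof (rule congruentI)
    fix x x' assume "(x, x') \<in> r"
    then have "(\<star>\<^bsub>S\<^esub> x, \<star>\<^bsub>S\<^esub> x') \<in> r"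
      using assms(1) unfolding star_congruence_def by blast
    then show "r `` {\<star>\<^bsub>S\<^esub> x} = r `` {\<star>\<^bsub>S\<^esub> x'}" using eq by (rule equiv_class_eq[rotated])
  qed
  from UN_equiv_class[OF eq this assms(2)] show ?thesis
    by (simp add: quotient_star_semigroup_def)
qed

lemma star_homI:
  assumes "\<And>x. x \<in> carrier S \<Longrightarrow> f x \<in> carrier T"
    and "\<And>x. x \<notin> carrier S \<Longrightarrow> f x = undefined"
    and "\<And>x y. \<lbrakk>x \<in> carrier S; y \<in> carrier S\<rbrakk> \<Longrightarrow> f (x \<odot>\<^bsub>S\<^esub> y) = f x \<odot>\<^bsub>T\<^esub> f y"
    and "\<And>x. x \<in> carrier S \<Longrightarrow> f (\<star>\<^bsub>S\<^esub> x) = \<star>\<^bsub>T\<^esub> (f x)"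
  shows "f \<in> star_hom S T"
  using assms by (auto simp: star_hom_def PiE_iff extensional_def)

lemma star_homD:
  assumes "f \<in> star_hom S T"
  shows "x \<in> carrier S \<Longrightarrow> f x \<in> carrier T"
    and "x \<notin> carrier S \<Longrightarrow> f x = undefined"
    and "\<lbrakk>x \<in> carrier S; y \<in> carrier S\<rbrakk> \<Longrightarrow> f (x \<odot>\<^bsub>S\<^esub> y) = f x \<odot>\<^bsub>T\<^esub> f y"
    and "x \<in> carrier S \<Longrightarrow> f (\<star>\<^bsub>S\<^esub> x) = \<star>\<^bsub>T\<^esub> (f x)"
  using assms by (auto simp: star_hom_def PiE_iff extensional_def)

text \<open>The kernel of \<open>f\<close> is a congruence containing \<open>R\<close>, hence contains the one generated by \<open>R\<close>.\<close>

lemma star_hom_respects_gen_congruence: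
  assumes S: "star_semigroup S" and f: "f \<in> star_hom S T"
    and sub: "R \<subseteq> carrier S \<times> carrier S" and R: "\<And>x y. (x, y) \<in> R \<Longrightarrow> f x = f y"
    and xy: "(x, y) \<in> gen_congruence S R"
  shows "f x = f y"
proof -
  interpret star_semigroup S by fact
  let ?K = "{(x, y). x \<in> carrier S \<and> y \<in> carrier S \<and> f x = f y}"
  have "star_congruence S ?K"
    using star_homD[OF f]
    by (auto simp: star_congruence_def equiv_def refl_on_def sym_def trans_def
        sprod_closed star_closed)
  moreover have "R \<subseteq> ?K" using sub R by auto
  ultimately have "(x, y) \<in> ?K" using xy unfolding gen_congruence_def by blast
  then show ?thesis by simp
qed

lemma star_hom_factors_through_quotient:
  assumes S: "star_semigroup S" and f: "f \<in> star_hom S T"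
    and sub: "R \<subseteq> carrier S \<times> carrier S" and R: "\<And>x y. (x, y) \<in> R \<Longrightarrow> f x = f y"
  shows "\<exists>g\<in>star_hom (quotient_star_semigroup S (gen_congruence S R)) T.
    \<forall>x\<in>carrier S. g (gen_congruence S R `` {x}) = f x"
proof -
  interpret star_semigroup S by fact
  let ?r = "gen_congruence S R"
  let ?Q = "quotient_star_semigroup S ?r"
  have cong: "star_congruence S ?r" by (rule star_congruence_gen[OF S sub])
  have eq: "equiv (carrier S) ?r" using cong by (simp add: star_congruence_def)
  have carr: "X \<in> carrier ?Q \<longleftrightarrow> (\<exists>x\<in>carrier S. X = ?r `` {x})" for X
    by (auto simp: quotient_star_semigroup_def quotient_def)
  define g where "g = (\<lambda>X\<in>carrier ?Q. f (SOME x. x \<in> X))"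
  have g: "g (?r `` {x}) = f x" if x: "x \<in> carrier S" for x
  proof -
    have "(SOME y. y \<in> ?r `` {x}) \<in> ?r `` {x}"
      using equiv_class_self[OF eq x] by (rule someI)
    then have "f x = f (SOME y. y \<in> ?r `` {x})"
      by (intro star_hom_respects_gen_congruence[OF S f sub R]) auto
    moreover have "?r `` {x} \<in> carrier ?Q" using carr x by blast
    ultimately show ?thesis by (simp add: g_def)
  qed
  have "g \<in> star_hom ?Q T"
  proof (rule star_homI)
    fix X Y assume "X \<in> carrier ?Q" "Y \<in> carrier ?Q"
    then show "g (X \<odot>\<^bsub>?Q\<^esub> Y) = g X \<odot>\<^bsub>T\<^esub> g Y"
      by (auto simp: carr quotient_sprod_class[OF cong] g sprod_closed star_homD[OF f])
  next
    fix X assume "X \<in> carrier ?Q"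
    then show "g X \<in> carrier T" "g (\<star>\<^bsub>?Q\<^esub> X) = \<star>\<^bsub>T\<^esub> (g X)"
      by (auto simp: carr quotient_star_class[OF cong] g star_closed star_homD[OF f])
  qed (simp add: g_def)
  then show ?thesis using g by blast
qed


section \<open>The partial isometry \<open>(1)\<close> generates \<open>A\<close>\<close>

lemma star_congruence_A_cong: "star_congruence Ac A_cong"
  unfolding A_cong_def by (intro star_congruence_gen star_semigroup_Ac A_rel_subset)

lemma A_class_sprod:
  "\<lbrakk>xs \<in> carrier Ac; ys \<in> carrier Ac\<rbrakk> \<Longrightarrow> A_class xs \<odot>\<^bsub>A\<^esub> A_class ys = A_class (xs \<odot>\<^bsub>Ac\<^esub> ys)"
  unfolding A_def A_class_def by (rule quotient_sprod_class[OF star_congruence_A_cong])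

lemma A_class_star: "xs \<in> carrier Ac \<Longrightarrow> \<star>\<^bsub>A\<^esub> (A_class xs) = A_class (\<star>\<^bsub>Ac\<^esub> xs)"
  unfolding A_def A_class_def by (rule quotient_star_class[OF star_congruence_A_cong])

lemma carrier_A_iff: "X \<in> carrier A \<longleftrightarrow> (\<exists>xs\<in>carrier Ac. X = A_class xs)"
  by (auto simp: A_def A_class_def quotient_star_semigroup_def quotient_def)

lemma singleton_in_Ac: "[n] \<in> carrier Ac \<longleftrightarrow> n \<noteq> 0"
  by (auto simp: Ac_def)

lemma A_generator_in_carrier: "A_class [1] \<in> carrier A"
  using carrier_A_iff singleton_in_Ac[of 1] by auto

text \<open>Entries of opposite sign are merely concatenated by the product, and equal signs are added
  up; so \<open>(n\<^sub>0, \<dots>, n\<^sub>k)\<close> is the product of the \<open>(n\<^sub>i)\<close>, and \<open>(n)\<close> is a power of \<open>(1)\<close> or of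
  \<open>(-1) = (1)\<^sup>*\<close>.\<close>

lemma Ac_generator_induct [consumes 1, case_names gen sprod star]:
  assumes xs: "xs \<in> carrier Ac"
    and gen: "Q [1]"
    and sprod: "\<And>xs ys. \<lbrakk>xs \<in> carrier Ac; ys \<in> carrier Ac; Q xs; Q ys\<rbrakk> \<Longrightarrow> Q (xs \<odot>\<^bsub>Ac\<^esub> ys)"
    and star: "\<And>xs. \<lbrakk>xs \<in> carrier Ac; Q xs\<rbrakk> \<Longrightarrow> Q (\<star>\<^bsub>Ac\<^esub> xs)"
  shows "Q xs"
proof -
  have pos: "Q [int (Suc k)]" for k
  proof (induction k)
    case (Suc k)
    have "[int (Suc (Suc k))] = [1] \<odot>\<^bsub>Ac\<^esub> [int (Suc k)]" by (simp add: Ac_def)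
    then show ?case using sprod[of "[1]" "[int (Suc k)]"] gen Suc by (simp add: singleton_in_Ac)
  qed (use gen in simp)
  have single: "Q [n]" if "n \<noteq> 0" for n
  proof (cases "n > 0")
    case True
    then have "n = int (Suc (nat n - 1))" by simp
    then show ?thesis using pos by metis
  next
    case False
    then have "- n = int (Suc (nat (- n) - 1))" using that by simp
    then have "Q [- n]" using pos by metis
    moreover have "[n] = \<star>\<^bsub>Ac\<^esub> [- n]" by (simp add: Ac_def)
    ultimately show ?thesis using star[of "[- n]"] that by (simp add: singleton_in_Ac)
  qed
  show ?thesis using xs
  proof (induction xs)
    case Nil
    then show ?case by (simp add: Ac_def)
  next
    case (Cons n xs)
    show ?case
    proof (cases "xs = []")
      case True
      then show ?thesis using single Cons.prems by (simp add: singleton_in_Ac)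
    next
      case False
      then have n: "n \<noteq> 0" and xs: "xs \<in> carrier Ac" and "sgn (hd xs) = - sgn n"
        using Cons.prems by (auto simp: Ac_def successively_Cons)
      then have "n # xs = [n] \<odot>\<^bsub>Ac\<^esub> xs" by (auto simp: Ac_def sgn_if split: if_splits)
      then show ?thesis using sprod[of "[n]" xs] single[OF n] Cons.IH[OF xs] n xs
        by (simp add: singleton_in_Ac)
    qed
  qed
qed

lemma A_generator_induct [consumes 1, case_names gen sprod star]:
  assumes X: "X \<in> carrier A"
    and gen: "Q (A_class [1])"
    and sprod: "\<And>X Y. \<lbrakk>X \<in> carrier A; Y \<in> carrier A; Q X; Q Y\<rbrakk> \<Longrightarrow> Q (X \<odot>\<^bsub>A\<^esub> Y)"
    and star: "\<And>X. \<lbrakk>X \<in> carrier A; Q X\<rbrakk> \<Longrightarrow> Q (\<star>\<^bsub>A\<^esub> X)"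
  shows "Q X"
proof -
  have "Q (A_class xs)" if "xs \<in> carrier Ac" for xs
    using that
  proof (induction rule: Ac_generator_induct)
    case (sprod xs ys)
    then show ?case using assms(3)[of "A_class xs" "A_class ys"]
      by (auto simp: A_class_sprod carrier_A_iff)
  next
    case (star xs)
    then show ?case using assms(4)[of "A_class xs"] by (auto simp: A_class_star carrier_A_iff)
  qed (fact gen)
  then show ?thesis using X carrier_A_iff by auto
qed

lemma A_hom_unique:
  assumes "f \<in> star_hom A T" "g \<in> star_hom A T" "f (A_class [1]) = g (A_class [1])"
  shows "f = g"
proof
  fix X
  show "f X = g X"
  proof (cases "X \<in> carrier A")
    case True
    then show ?thesis
      by (induction rule: A_generator_induct)
        (simp_all add: assms star_homD[OF assms(1)] star_homD[OF assms(2)])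
  qed (simp add: star_homD[OF assms(1)] star_homD[OF assms(2)])
qed

text \<open>Here \<open>(1)(1)\<^sup>*(1) = (1, -1, 1)\<close>, which is identified with \<open>(1 - 1 + 1) = (1)\<close>.\<close>

lemma partial_isometry_A_generator: "partial_isometry A (A_class [1])"
proof -
  have "[1, -1, 1] \<in> carrier Ac" by (simp add: Ac_def)
  then have "([1, -1, 1], [1]) \<in> A_rel"
    unfolding A_rel_def
    by (intro CollectI exI[of _ "[]"] exI[of _ 1] exI[of _ "-1"]) simp
  then have "([1, -1, 1], [1]) \<in> A_cong" unfolding A_cong_def gen_congruence_def by blast
  then have "A_class [1, -1, 1] = A_class [1]"
    using star_congruence_A_cong unfolding A_class_def star_congruence_def
    by (metis equiv_class_eq)
  moreover have "[1, -1] \<in> carrier Ac" "\<star>\<^bsub>Ac\<^esub> [1] = [-1]"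
    "[1] \<odot>\<^bsub>Ac\<^esub> [-1] = [1, -1]" "[1, -1] \<odot>\<^bsub>Ac\<^esub> [1] = [1, -1, 1]"
    by (simp_all add: Ac_def)
  ultimately have "A_class [1] \<odot>\<^bsub>A\<^esub> (\<star>\<^bsub>A\<^esub> (A_class [1])) \<odot>\<^bsub>A\<^esub> A_class [1] = A_class [1]"
    by (simp add: A_class_star A_class_sprod singleton_in_Ac)
  then show ?thesis by (simp add: partial_isometry_def A_generator_in_carrier)
qed

lemma partial_isometry_image:
  assumes "star_semigroup S" "f \<in> star_hom S T" "partial_isometry S x"
  shows "partial_isometry T (f x)"
proof -
  interpret star_semigroup S by fact
  have x: "x \<in> carrier S" and "x \<odot>\<^bsub>S\<^esub> (\<star>\<^bsub>S\<^esub> x) \<odot>\<^bsub>S\<^esub> x = x"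
    using assms(3) by (simp_all add: partial_isometry_def)
  then have "f (x \<odot>\<^bsub>S\<^esub> (\<star>\<^bsub>S\<^esub> x) \<odot>\<^bsub>S\<^esub> x) = f x" by simp
  then show ?thesis
    by (simp add: partial_isometry_def star_homD[OF assms(2)] x sprod_closed star_closed)
qed


section \<open>Partial isometries are images of \<open>(1)\<close>\<close>

text \<open>Spelling out each entry in unary turns the product of \<open>Ac\<close>, with its two cases, into plain
  concatenation of words in the letters \<open>1\<close> and \<open>-1\<close>.\<close>

definition unary :: "int \<Rightarrow> int list" where
  "unary n = replicate (nat \<bar>n\<bar>) (sgn n)"

definition unary_word :: "int list \<Rightarrow> int list" where
  "unary_word xs = concat (map unary xs)"

lemma unary_add: "sgn a = sgn b \<Longrightarrow> unary (a + b) = unary a @ unary b"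
  by (auto simp: unary_def sgn_if nat_add_distrib[symmetric] replicate_add[symmetric]
      split: if_splits intro!: arg_cong2[where f = replicate])

lemma unary_uminus: "unary (- n) = map uminus (rev (unary n))"
  by (simp add: unary_def sgn_minus)

lemma unary_word_sprod:
  assumes "xs \<in> carrier Ac" "ys \<in> carrier Ac"
  shows "unary_word (xs \<odot>\<^bsub>Ac\<^esub> ys) = unary_word xs @ unary_word ys"
proof -
  obtain us a where xs: "xs = us @ [a]" using A_c_ends(3)[OF assms(1)] by (metis rev_exhaust)
  obtain b vs where ys: "ys = b # vs" using A_c_ends(3)[OF assms(2)] by (metis list.exhaust)
  show ?thesis by (simp add: Ac_def xs ys unary_word_def unary_add)
qed

lemma unary_word_star: "unary_word (\<star>\<^bsub>Ac\<^esub> xs) = map uminus (rev (unary_word xs))"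
  by (induction xs) (simp_all add: Ac_def unary_word_def unary_uminus)

lemma unary_word_not_Nil: "xs \<in> carrier Ac \<Longrightarrow> unary_word xs \<noteq> []"
  by (cases xs) (auto simp: Ac_def unary_word_def unary_def)

text \<open>In unary, \<open>(a, e, b)\<close> is a run of \<open>\<bar>a\<bar>\<close> letters \<open>s = -e\<close>, one letter \<open>-s\<close> and a run of \<open>\<bar>b\<bar>\<close>
  letters \<open>s\<close>, while \<open>(a + e + b)\<close> is a single run with one letter \<open>s\<close> less in total.\<close>

lemma unary_word_A_rel:
  assumes "(xs, ys) \<in> A_rel"
  shows "\<exists>ps qs s. unary_word xs = ps @ [s, - s, s] @ qs \<and> unary_word ys = ps @ [s] @ qs
    \<and> s \<noteq> 0"
proof -
  obtain us a e b vs where xs: "xs = us @ [a, e, b] @ vs" and ys: "ys = us @ [a + e + b] @ vs"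
    and c: "us @ [a, e, b] @ vs \<in> carrier Ac" and e: "e = 1 \<or> e = -1"
    using assms unfolding A_rel_def by blast
  have sg: "a \<noteq> 0" "b \<noteq> 0" "sgn a = - e" "sgn b = - e" using c e
    by (auto simp: Ac_def successively_append_iff successively_Cons)
  define s k l where "s = - e" and "k = nat \<bar>a\<bar> - 1" and "l = nat \<bar>b\<bar> - 1"
  have "nat \<bar>a\<bar> = k + 1" "nat \<bar>b\<bar> = 1 + l" using sg by (auto simp: k_def l_def)
  then have a: "unary a = replicate k s @ [s]" and b: "unary b = [s] @ replicate l s"
    using sg by (simp_all add: unary_def s_def replicate_append_same)
  have "unary e = [- s]" using e by (auto simp: unary_def s_def)
  \<comment> \<open>The sign of \<open>e\<close> is opposite to that of \<open>a\<close> and \<open>b\<close>, so \<open>\<bar>a + e + b\<bar> = \<bar>a\<bar> + \<bar>b\<bar> - 1\<close>.\<close>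
  moreover have "nat \<bar>a + e + b\<bar> = k + 1 + l" "sgn (a + e + b) = s"
    using sg e by (auto simp: k_def l_def s_def sgn_if split: if_splits)
  then have "unary (a + e + b) = replicate k s @ [s] @ replicate l s"
    by (simp add: unary_def replicate_add replicate_app_Cons_same)
  ultimately have "unary_word xs
      = (unary_word us @ replicate k s) @ [s, - s, s] @ (replicate l s @ unary_word vs)"
    "unary_word ys = (unary_word us @ replicate k s) @ [s] @ (replicate l s @ unary_word vs)"
    by (simp_all add: xs ys unary_word_def a b)
  moreover have "s \<noteq> 0" using e by (auto simp: s_def)
  ultimately show ?thesis by blast
qed

text \<open>A semigroup has no empty product, so the value at \<open>[]\<close> is only a default.\<close>

fun sprod_list :: "('a, 'm) star_semigroup_scheme \<Rightarrow> 'a list \<Rightarrow> 'a" where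
  "sprod_list T [] = undefined"
| "sprod_list T [x] = x"
| "sprod_list T (x # y # zs) = x \<odot>\<^bsub>T\<^esub> sprod_list T (y # zs)"

context star_semigroup
begin

lemma sprod_list_Cons: "xs \<noteq> [] \<Longrightarrow> sprod_list S (x # xs) = x \<odot> sprod_list S xs"
  by (cases xs) simp_all

lemma sprod_list_closed:
  assumes "xs \<noteq> []" "set xs \<subseteq> carrier S"
  shows "sprod_list S xs \<in> carrier S"
  using assms
proof (induction xs)
  case (Cons x xs)
  then show ?case by (cases "xs = []") (simp_all add: sprod_list_Cons sprod_closed)
qed simp

lemma sprod_list_append:
  assumes "xs \<noteq> []" "ys \<noteq> []" "set xs \<subseteq> carrier S" "set ys \<subseteq> carrier S"
  shows "sprod_list S (xs @ ys) = sprod_list S xs \<odot> sprod_list S ys"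
  using assms(1,3)
proof (induction xs)
  case (Cons x xs)
  then show ?case using assms(2,4)
    by (cases "xs = []") (simp_all add: sprod_list_Cons sprod_assoc sprod_list_closed)
qed simp

lemma sprod_list_star:
  assumes "xs \<noteq> []" "set xs \<subseteq> carrier S"
  shows "sprod_list S (map (star S) (rev xs)) = \<star> (sprod_list S xs)"
  using assms
proof (induction xs)
  case (Cons x xs)
  show ?case
  proof (cases "xs = []")
    case False
    then have "sprod_list S (map (star S) (rev xs)) = \<star> (sprod_list S xs)"
      and "set (map (star S) (rev xs)) \<subseteq> carrier S"
      using Cons star_closed by auto
    then show ?thesis using False Cons.prems
      by (simp add: sprod_list_Cons sprod_list_append star_sprod sprod_list_closed star_closed)
  qed simp
qed simp

text \<open>Equal factors may be exchanged inside a product whatever surrounds them; the surrounding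
  words may be empty, and then there is no factor to split off.\<close>

lemma sprod_list_replace:
  assumes eq: "sprod_list S xs = sprod_list S ys" and ne: "xs \<noteq> []" "ys \<noteq> []"
    and sub: "set (ps @ xs @ qs) \<subseteq> carrier S" "set ys \<subseteq> carrier S"
  shows "sprod_list S (ps @ xs @ qs) = sprod_list S (ps @ ys @ qs)"
proof -
  have "sprod_list S (xs @ qs) = sprod_list S (ys @ qs)"
    using eq ne sub by (cases "qs = []") (simp_all add: sprod_list_append)
  then show ?thesis
    using ne sub by (cases "ps = []") (simp_all add: sprod_list_append)
qed

end

text \<open>A sequence is sent to the product of the letters of its unary word, with \<open>1\<close> read as \<open>w\<close> and
  \<open>-1\<close> as \<open>w\<^sup>*\<close>.  This respects the relations of \<open>A\<close> because of \<open>w w\<^sup>* w = w\<close> and its adjoint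
  \<open>w\<^sup>* w w\<^sup>* = w\<^sup>*\<close>.\<close>

lemma A_hom_exists:
  assumes T: "star_semigroup T" and w: "partial_isometry T w"
  shows "\<exists>f\<in>star_hom A T. f (A_class [1]) = w"
proof -
  interpret T: star_semigroup T by fact
  have w: "w \<in> carrier T" and www: "w \<odot>\<^bsub>T\<^esub> (\<star>\<^bsub>T\<^esub> w) \<odot>\<^bsub>T\<^esub> w = w"
    using w by (simp_all add: partial_isometry_def)
  define letter where "letter s = (if s > 0 then w else \<star>\<^bsub>T\<^esub> w)" for s :: int
  have letter: "letter s \<in> carrier T" for s by (simp add: letter_def w T.star_closed)
  then have set: "set (map letter zs) \<subseteq> carrier T" for zs by auto
  have letter_uminus: "letter (- s) = \<star>\<^bsub>T\<^esub> (letter s)" if "s \<noteq> 0" for s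
    using that by (simp add: letter_def T.star_star w)
  have letter_cancel: "letter s \<odot>\<^bsub>T\<^esub> (letter (- s) \<odot>\<^bsub>T\<^esub> letter s) = letter s"
    if "s \<noteq> 0" for s
  proof -
    have "(\<star>\<^bsub>T\<^esub> w) \<odot>\<^bsub>T\<^esub> (w \<odot>\<^bsub>T\<^esub> (\<star>\<^bsub>T\<^esub> w)) = \<star>\<^bsub>T\<^esub> (w \<odot>\<^bsub>T\<^esub> (\<star>\<^bsub>T\<^esub> w) \<odot>\<^bsub>T\<^esub> w)"
      by (simp add: T.star_sprod T.sprod_closed T.star_closed T.star_star w)
    also have "\<dots> = \<star>\<^bsub>T\<^esub> w" by (simp add: www)
    finally show ?thesis
      using www that by (auto simp: letter_def T.sprod_assoc w T.star_closed)
  qed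
  define f where "f = (\<lambda>xs\<in>carrier Ac. sprod_list T (map letter (unary_word xs)))"
  have f_star_hom: "f \<in> star_hom Ac T"
  proof (rule star_homI)
    fix xs ys assume "xs \<in> carrier Ac" "ys \<in> carrier Ac"
    then show "f (xs \<odot>\<^bsub>Ac\<^esub> ys) = f xs \<odot>\<^bsub>T\<^esub> f ys"
      using set star_semigroup.sprod_closed[OF star_semigroup_Ac]
      by (simp add: f_def unary_word_sprod T.sprod_list_append unary_word_not_Nil)
  next
    fix xs assume xs: "xs \<in> carrier Ac"
    then show "f xs \<in> carrier T"
      using set by (simp add: f_def T.sprod_list_closed unary_word_not_Nil)
    have "0 \<notin> set (unary_word xs)" using xs by (auto simp: Ac_def unary_word_def unary_def sgn_if)
    then have "map (letter \<circ> uminus) (rev (unary_word xs))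
        = map (star T) (rev (map letter (unary_word xs)))"
      using letter_uminus by (auto simp: rev_map intro!: map_cong) metis
    then show "f (\<star>\<^bsub>Ac\<^esub> xs) = \<star>\<^bsub>T\<^esub> (f xs)"
      using xs set star_semigroup.star_closed[OF star_semigroup_Ac]
      by (simp add: f_def unary_word_star T.sprod_list_star unary_word_not_Nil)
  qed (simp add: f_def)
  have "f xs = f ys" if rel: "(xs, ys) \<in> A_rel" for xs ys
  proof -
    obtain ps qs s where "unary_word xs = ps @ [s, - s, s] @ qs" "unary_word ys = ps @ [s] @ qs"
      and s: "s \<noteq> 0"
      using unary_word_A_rel[OF rel] by blast
    moreover have "sprod_list T (map letter ps @ map letter [s, - s, s] @ map letter qs)
        = sprod_list T (map letter ps @ map letter [s] @ map letter qs)"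
    proof (rule T.sprod_list_replace)
      show "sprod_list T (map letter [s, - s, s]) = sprod_list T (map letter [s])"
        using letter_cancel[OF s] by simp
    qed (use letter in auto)
    moreover have "xs \<in> carrier Ac" "ys \<in> carrier Ac" using rel A_rel_subset by auto
    ultimately show ?thesis by (simp add: f_def)
  qed
  then obtain g where "g \<in> star_hom A T" "\<forall>xs\<in>carrier Ac. g (A_class xs) = f xs"
    using star_hom_factors_through_quotient[OF star_semigroup_Ac f_star_hom A_rel_subset]
    unfolding A_def A_class_def A_cong_def by blast
  moreover have "f [1] = w"
    by (simp add: f_def singleton_in_Ac unary_word_def unary_def letter_def)
  ultimately show ?thesis by (metis singleton_in_Ac zero_neq_one)
qed


section \<open>Contractivity\<close>

context cstar_algebra
begin

lemma norm_star_le: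
  assumes x: "x \<in> carrier B"
  shows "\<parallel>\<star> x\<parallel> \<le> \<parallel>x\<parallel>"
proof (cases "\<parallel>\<star> x\<parallel> = 0")
  case True
  then show ?thesis using norm_nonneg[OF x] by simp
next
  case False
  have sx: "\<star> x \<in> carrier B" using x by (rule star_closed)
  have "\<parallel>\<star> x\<parallel>\<^sup>2 = \<parallel>x \<odot> \<star> x\<parallel>" using cstar_identity[OF sx] by (simp add: star_star x)
  also have "\<dots> \<le> \<parallel>x\<parallel> * \<parallel>\<star> x\<parallel>" using norm_sprod x sx by simp
  finally show ?thesis using False norm_nonneg[OF sx] by (simp add: power2_eq_square)
qed

text \<open>The element \<open>x\<^sup>* x\<close> is a projection, and the norm of a projection is idempotent by the
  \<open>C\<^sup>*\<close>-identity, hence 0 or 1.\<close>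

lemma partial_isometry_norm_le_1:
  assumes "partial_isometry B x"
  shows "\<parallel>x\<parallel> \<le> 1"
proof -
  have x: "x \<in> carrier B" and xxx: "x \<odot> \<star> x \<odot> x = x"
    using assms by (simp_all add: partial_isometry_def)
  define p where "p = \<star> x \<odot> x"
  have p: "p \<in> carrier B" by (simp add: p_def x sprod_closed star_closed)
  have "\<star> p = p" by (simp add: p_def x star_sprod star_closed star_star)
  moreover have "p \<odot> p = p"
    using xxx by (simp add: p_def x sprod_assoc sprod_closed star_closed)
  ultimately have "\<parallel>p\<parallel>\<^sup>2 = \<parallel>p\<parallel>" using cstar_identity[OF p] by simp
  then have "\<parallel>p\<parallel> \<le> 1" by (auto simp: power2_eq_square)
  then have "\<parallel>x\<parallel>\<^sup>2 \<le> 1" using cstar_identity[OF x] by (simp add: p_def)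
  then show ?thesis by (simp add: power_le_one_iff norm_nonneg[OF x])
qed

end

text \<open>The image of \<open>(1)\<close> is a partial isometry, and the unit ball is closed under the operations that
  generate \<open>A\<close> from \<open>(1)\<close>.\<close>

lemma A_hom_contractive:
  assumes "cstar_algebra B" and f: "f \<in> star_hom A B"
  shows "f \<in> contractive_hom A B"
proof -
  interpret B: cstar_algebra B by fact
  have "\<parallel>f X\<parallel>\<^bsub>B\<^esub> \<le> 1" if "X \<in> carrier A" for X
    using that
  proof (induction rule: A_generator_induct)
    case gen
    show ?case
      using partial_isometry_image[OF star_semigroup_A f partial_isometry_A_generator]
      by (rule B.partial_isometry_norm_le_1)
  next
    case (sprod X Y)
    then have c: "f X \<in> carrier B" "f Y \<in> carrier B" by (simp_all add: star_homD[OF f])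
    have "\<parallel>f (X \<odot>\<^bsub>A\<^esub> Y)\<parallel>\<^bsub>B\<^esub> \<le> \<parallel>f X\<parallel>\<^bsub>B\<^esub> * \<parallel>f Y\<parallel>\<^bsub>B\<^esub>"
      using sprod c by (simp add: star_homD[OF f] B.norm_sprod)
    also have "\<dots> \<le> 1" using sprod c by (simp add: mult_le_one B.norm_nonneg)
    finally show ?case .
  next
    case (star X)
    then have "\<parallel>f (\<star>\<^bsub>A\<^esub> X)\<parallel>\<^bsub>B\<^esub> \<le> \<parallel>f X\<parallel>\<^bsub>B\<^esub>"
      by (simp add: star_homD[OF f] B.norm_star_le)
    then show ?case using star by simp
  qed
  then show ?thesis using f by (simp add: contractive_hom_def)
qed


section \<open>Comparing the universal algebras\<close>

lemma cstar_hom_star_hom: "f \<in> cstar_hom B D \<Longrightarrow> f \<in> star_hom B D"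
  by (simp add: cstar_hom_def)

lemma star_hom_compose:
  assumes "star_semigroup S" "f \<in> star_hom S T" "g \<in> star_hom T U"
  shows "compose (carrier S) g f \<in> star_hom S U"
proof -
  interpret star_semigroup S by fact
  show ?thesis
    by (rule star_homI)
      (auto simp: compose_def sprod_closed star_closed star_homD[OF assms(2)]
        star_homD[OF assms(3)])
qed

lemma (in cstar_algebra) add_closed:
  "\<lbrakk>x \<in> carrier B; y \<in> carrier B\<rbrakk> \<Longrightarrow> x \<oplus> y \<in> carrier B"
proof -
  interpret comm_group "\<lparr>carrier = carrier B, mult = cadd B, one = czero B\<rparr>"
    by (rule add_comm_group)
  show "\<lbrakk>x \<in> carrier B; y \<in> carrier B\<rbrakk> \<Longrightarrow> x \<oplus> y \<in> carrier B" using m_closed by simp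
qed

lemma cstar_hom_compose:
  assumes "cstar_algebra B" "f \<in> cstar_hom B D" "g \<in> cstar_hom D E"
  shows "compose (carrier B) g f \<in> cstar_hom B E"
proof -
  interpret cstar_algebra B by fact
  have "f x \<in> carrier D" if "x \<in> carrier B" for x
    using star_homD(1)[OF cstar_hom_star_hom[OF assms(2)] that] .
  then show ?thesis
    using assms star_hom_compose[OF star_semigroup_axioms, of f D g E]
    by (auto simp: cstar_hom_def compose_def add_closed scale_closed)
qed

lemma cstar_hom_id:
  assumes "cstar_algebra B"
  shows "(\<lambda>x\<in>carrier B. x) \<in> cstar_hom B B"
proof -
  interpret cstar_algebra B by fact
  show ?thesis
    by (auto simp: cstar_hom_def add_closed scale_closed sprod_closed star_closed intro!: star_homI)
qed

lemma Ex1_unique: "\<lbrakk>\<exists>!x. Q x; Q x; Q y\<rbrakk> \<Longrightarrow> x = y"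
  by blast

theorem theorem2p9:
  fixes C P :: "'u cstar_algebra" and \<iota> :: "int list set \<Rightarrow> 'u" and v :: 'u
  assumes "is_universal_cstar A C \<iota>"
    and "is_universal_partial_isometry P v"
  shows "(\<exists>!\<sigma>. \<sigma> \<in> contractive_hom A P \<and> \<sigma> (A_class [1]) = v) \<and>
    (\<forall>\<sigma>. \<sigma> \<in> contractive_hom A P \<and> \<sigma> (A_class [1]) = v \<longrightarrow>
       induced_hom A C \<iota> P \<sigma> \<in> cstar_iso C P)"
proof (intro conjI allI impI)
  have P: "cstar_algebra P" and v: "partial_isometry P v"
    and P_univ: "\<And>(B :: 'u cstar_algebra) w. cstar_algebra B \<Longrightarrow> partial_isometry B w \<Longrightarrow>
      \<exists>!\<pi>. \<pi> \<in> cstar_hom P B \<and> \<pi> v = w"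
    using assms(2) unfolding is_universal_partial_isometry_def by blast+
  have C: "cstar_algebra C" and \<iota>: "\<iota> \<in> contractive_hom A C"
    and C_univ: "\<And>(B :: 'u cstar_algebra) \<gamma>. cstar_algebra B \<Longrightarrow> \<gamma> \<in> contractive_hom A B \<Longrightarrow>
      \<exists>!\<pi>. \<pi> \<in> cstar_hom C B \<and> (\<forall>s\<in>carrier A. \<pi> (\<iota> s) = \<gamma> s)"
    using assms(1) unfolding is_universal_cstar_def by blast+
  have contr: "\<gamma> \<in> star_hom A B" if "\<gamma> \<in> contractive_hom A B" for \<gamma> and B :: "'u cstar_algebra"
    using that by (simp add: contractive_hom_def)

  show "\<exists>!\<sigma>. \<sigma> \<in> contractive_hom A P \<and> \<sigma> (A_class [1]) = v"
  proof (rule ex_ex1I)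
    show "\<exists>\<sigma>. \<sigma> \<in> contractive_hom A P \<and> \<sigma> (A_class [1]) = v"
      using A_hom_exists[OF cstar_algebra.axioms(1)[OF P] v] A_hom_contractive[OF P] by blast
  next
    fix \<sigma> \<tau>
    assume "\<sigma> \<in> contractive_hom A P \<and> \<sigma> (A_class [1]) = v"
      and "\<tau> \<in> contractive_hom A P \<and> \<tau> (A_class [1]) = v"
    then show "\<sigma> = \<tau>" by (intro A_hom_unique[of _ P]) (simp_all add: contr)
  qed

  fix \<sigma> assume "\<sigma> \<in> contractive_hom A P \<and> \<sigma> (A_class [1]) = v"
  then have \<sigma>: "\<sigma> \<in> contractive_hom A P" and \<sigma>v: "\<sigma> (A_class [1]) = v" by auto
  define \<pi> where "\<pi> = induced_hom A C \<iota> P \<sigma>"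
  have "\<pi> \<in> cstar_hom C P \<and> (\<forall>s\<in>carrier A. \<pi> (\<iota> s) = \<sigma> s)"
    unfolding \<pi>_def induced_hom_def by (rule theI'[OF C_univ[OF P \<sigma>]])
  then have \<pi>: "\<pi> \<in> cstar_hom C P" and \<pi>\<iota>: "\<And>s. s \<in> carrier A \<Longrightarrow> \<pi> (\<iota> s) = \<sigma> s" by auto

  have "partial_isometry C (\<iota> (A_class [1]))"
    using partial_isometry_image[OF star_semigroup_A contr[OF \<iota>] partial_isometry_A_generator] .
  from P_univ[OF C this] obtain \<rho>
    where \<rho>: "\<rho> \<in> cstar_hom P C" and \<rho>v: "\<rho> v = \<iota> (A_class [1])" by blast
  have v_carr: "v \<in> carrier P" using v by (simp add: partial_isometry_def)
  have \<iota>_carr: "\<iota> s \<in> carrier C" if "s \<in> carrier A" for s using star_homD(1)[OF contr[OF \<iota>] that] .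

  have "compose (carrier P) \<pi> \<rho> = (\<lambda>x\<in>carrier P. x)"
  proof (rule Ex1_unique[OF P_univ[OF P v]])
    have "compose (carrier P) \<pi> \<rho> v = v"
      using v_carr by (simp add: compose_def \<rho>v \<pi>\<iota> \<sigma>v A_generator_in_carrier)
    with cstar_hom_compose[OF P \<rho> \<pi>]
    show "compose (carrier P) \<pi> \<rho> \<in> cstar_hom P P \<and> compose (carrier P) \<pi> \<rho> v = v" ..
    show "(\<lambda>x\<in>carrier P. x) \<in> cstar_hom P P \<and> (\<lambda>x\<in>carrier P. x) v = v"
      using cstar_hom_id[OF P] v_carr by simp
  qed
  then have \<pi>\<rho>: "\<pi> (\<rho> y) = y" if "y \<in> carrier P" for y
    using that by (metis compose_eq restrict_apply')

  have "compose (carrier C) \<rho> \<pi> = (\<lambda>x\<in>carrier C. x)"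
  proof (rule Ex1_unique[OF C_univ[OF C \<iota>]])
    \<comment> \<open>The universal property of \<open>C\<close> asks for agreement on the whole image of \<open>\<iota>\<close>, but homomorphisms
      from \<open>A\<close> need only be compared at \<open>(1)\<close>.\<close>
    have "compose (carrier A) \<rho> \<sigma> = \<iota>"
    proof (rule A_hom_unique)
      show "compose (carrier A) \<rho> \<sigma> \<in> star_hom A C"
        by (rule star_hom_compose[OF star_semigroup_A contr[OF \<sigma>] cstar_hom_star_hom[OF \<rho>]])
      show "compose (carrier A) \<rho> \<sigma> (A_class [1]) = \<iota> (A_class [1])"
        by (simp add: compose_def A_generator_in_carrier \<sigma>v \<rho>v)
    qed (rule contr[OF \<iota>])
    then have "\<rho> (\<sigma> s) = \<iota> s" if "s \<in> carrier A" for s using that by (metis compose_eq)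
    then have "\<forall>s\<in>carrier A. compose (carrier C) \<rho> \<pi> (\<iota> s) = \<iota> s"
      by (simp add: compose_def \<iota>_carr \<pi>\<iota>)
    with cstar_hom_compose[OF C \<pi> \<rho>]
    show "compose (carrier C) \<rho> \<pi> \<in> cstar_hom C C
      \<and> (\<forall>s\<in>carrier A. compose (carrier C) \<rho> \<pi> (\<iota> s) = \<iota> s)" ..
    show "(\<lambda>x\<in>carrier C. x) \<in> cstar_hom C C \<and> (\<forall>s\<in>carrier A. (\<lambda>x\<in>carrier C. x) (\<iota> s) = \<iota> s)"
      using cstar_hom_id[OF C] by (simp add: \<iota>_carr)
  qed
  then have \<rho>\<pi>: "\<rho> (\<pi> x) = x" if "x \<in> carrier C" for x
    using that by (metis compose_eq restrict_apply')

  have "bij_betw \<pi> (carrier C) (carrier P)"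
    using star_homD(1)[OF cstar_hom_star_hom[OF \<pi>]] star_homD(1)[OF cstar_hom_star_hom[OF \<rho>]]
    by (intro bij_betw_byWitness[where f' = \<rho>]) (auto simp: \<rho>\<pi> \<pi>\<rho>)
  then show "induced_hom A C \<iota> P \<sigma> \<in> cstar_iso C P"
    using \<pi> by (simp add: cstar_iso_def \<pi>_def)
qed

end
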